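(* Let $G=(V,E)$ be the directed graph (loops allowed) with vertex set $V=\{0,1,\ldots,9\}$ and edge set $$E=\{(a,b)\in V\times V \mid \text{there exists } x\in[a]^+ \text{ with } \operatorname{Col}(x)\in[b]^+\}.$$ For $a\in V$, let $\deg(a)$ denote the out-degree of $a$ in $G$, i.e. the number of $b\in V$ with $(a,b)\in E$. Then for every $a\in\{0,1,\ldots,9\}$: (1) $\deg(a)=1$ if and only if $a$ is odd. (2) $\deg(a)=2$ if and only if $a$ is even.
   Context: $\mathbb{N}$ denotes the set of positive integers. The Collatz function $\operatorname{Col}:\mathbb{N}\to\mathbb{N}$ is defined by $\operatorname{Col}(x)=x/2$ if $x$ is even and $\operatorname{Col}(x)=3x+1$ if $x$ is odd. For an integer $m$, $[m]^+$ denotes the set of positive integers congruent to $m$ modulo $10$. *)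

theory Defs
  imports "HOL-Number_Theory.Cong" "Graph_Theory.Digraph"
begin

text \<open>Positive integers are the elements of \<^typ>\<open>nat\<close> other than \<open>0\<close>; the value
  \<open>Col 0 = 0\<close> is a junk value, outside the domain of the Collatz function.\<close>

definition Col :: "nat \<Rightarrow> nat" where
  "Col x = (if even x then x div 2 else 3 * x + 1)"

text \<open>The set \<open>[m]\<^sup>+\<close> of positive integers congruent to \<open>m\<close> modulo 10.\<close>

definition pos_residue_class :: "int \<Rightarrow> nat set" where
  "pos_residue_class m = {x. 0 < x \<and> [int x = m] (mod 10)}"

text \<open>The arcs are the edges \<open>(a, b)\<close> themselves, so that there are no parallel arcs
  and \<^const>\<open>out_degree\<close> at \<open>a\<close> counts the \<open>b\<close> such that \<open>(a, b)\<close> is an edge.\<close>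

definition Col_graph :: "(int, int \<times> int) pre_digraph" where
  "Col_graph =
    \<lparr>verts = {0..9},
     arcs = {(a, b) \<in> {0..9} \<times> {0..9}.
       \<exists>x \<in> pos_residue_class a. Col x \<in> pos_residue_class b},
     tail = fst, head = snd\<rparr>"

end

theory Submission
  imports Defs
begin

text \<open>Since 10 is even, a residue modulo 10 fixes the parity of x, hence which branch of
  \<open>Col\<close> applies. If a is odd, 3x + 1 is determined modulo 10 by a, so there is exactly
  one successor (\<open>Col_successors_odd\<close>). If a is even, write x = a + 10k; then x/2 = a/2
  + 5k, whose residue depends only on the parity of k. Both parities occur, giving the two distinct
  successors a/2 and a/2 + 5 (\<open>Col_successors_even\<close>). As out-degrees count successors,
  both equivalences follow.\<close>

lemma out_arcs_Col_graph:
  assumes "a \<in> {0..9}"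
  shows "out_arcs Col_graph a =
    Pair a ` {b \<in> {0..9}. \<exists>x \<in> pos_residue_class a. Col x \<in> pos_residue_class b}"
  using assms unfolding out_arcs_def Col_graph_def by fastforce

lemma out_degree_Col_graph:
  assumes "a \<in> {0..9}"
  shows "out_degree Col_graph a =
    card {b \<in> {0..9}. \<exists>x \<in> pos_residue_class a. Col x \<in> pos_residue_class b}"
  unfolding out_degree_def out_arcs_Col_graph[OF assms] by (simp add: card_image inj_on_def)

lemma Col_successors_odd:
  assumes "a \<in> {0..9}" and "odd a"
  shows "{b \<in> {0..9}. \<exists>x \<in> pos_residue_class a. Col x \<in> pos_residue_class b}
    = {(3 * a + 1) mod 10}"
proof (intro equalityI subsetI)
  fix b assume "b \<in> {b \<in> {0..9}. \<exists>x \<in> pos_residue_class a. Col x \<in> pos_residue_class b}"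
  then obtain x where b: "b \<in> {0..9}" and x: "int x mod 10 = a mod 10"
    and Col_x: "int (Col x) mod 10 = b mod 10"
    by (auto simp: pos_residue_class_def cong_def)
  have "odd x"
    using x \<open>odd a\<close> by presburger
  then have "(3 * int x + 1) mod 10 = b mod 10"
    using Col_x by (simp add: Col_def add.commute)
  moreover have "(3 * int x + 1) mod 10 = (3 * a + 1) mod 10"
    using x by (intro mod_add_cong mod_mult_cong refl)
  ultimately show "b \<in> {(3 * a + 1) mod 10}"
    using b by simp
next
  fix b assume "b \<in> {(3 * a + 1) mod 10}"
  \<comment> \<open>Being odd, a is nonzero, so a itself is a positive representative of its
    class.\<close>
  moreover have "nat a \<in> pos_residue_class a"
    using assms by (auto simp: pos_residue_class_def elim: oddE)
  moreover have "Col (nat a) \<in> pos_residue_class ((3 * a + 1) mod 10)"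
    using assms by (simp add: pos_residue_class_def Col_def even_nat_iff cong_def add.commute)
  ultimately show "b \<in> {b \<in> {0..9}. \<exists>x \<in> pos_residue_class a. Col x \<in> pos_residue_class b}"
    by auto
qed

text \<open>Halving turns information modulo 10 into information modulo 5 only, and each class
  modulo 5 meets 0..9 in two elements.\<close>

lemma Col_successors_even:
  assumes "a \<in> {0..9}" and "even a"
  shows "{b \<in> {0..9}. \<exists>x \<in> pos_residue_class a. Col x \<in> pos_residue_class b}
    = {a div 2, a div 2 + 5}"
proof (intro equalityI subsetI)
  fix b assume "b \<in> {b \<in> {0..9}. \<exists>x \<in> pos_residue_class a. Col x \<in> pos_residue_class b}"
  then obtain x where b: "b \<in> {0..9}" and x: "int x mod 10 = a mod 10"
    and Col_x: "int (Col x) mod 10 = b mod 10"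
    by (auto simp: pos_residue_class_def cong_def)
  obtain c where c: "a = 2 * c"
    using \<open>even a\<close> by blast
  have "even x"
    using x \<open>even a\<close> by presburger
  then obtain y where y: "x = 2 * y"
    by blast
  have "int y mod 10 = b mod 10"
    using Col_x y by (simp add: Col_def)
  then have "(int y mod 10) mod 5 = (b mod 10) mod 5"
    by simp
  then have "int y mod 5 = b mod 5"
    by (simp add: mod_mod_cancel)
  \<comment> \<open>The modulus is written as 2 * 5 so that the common factor 2 can be
    cancelled.\<close>
  moreover have "(2 * int y) mod (2 * 5) = (2 * c) mod (2 * 5)"
    using x c y by simp
  then have "int y mod 5 = c mod 5"
    unfolding mult_mod_right[symmetric] by simp
  ultimately have "b mod 5 = c mod 5"
    by simp
  moreover have "0 \<le> c" "c \<le> 4" "0 \<le> b" "b \<le> 9"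
    using assms b c by auto
  ultimately have "b = c \<or> b = c + 5"
    by presburger
  then show "b \<in> {a div 2, a div 2 + 5}"
    using c by simp
next
  fix b assume b: "b \<in> {a div 2, a div 2 + 5}"
  obtain c where c: "a = 2 * c"
    using \<open>even a\<close> by blast
  text \<open>Halving \<open>a + 10\<close> and \<open>a + 20\<close> gives the two residues; \<open>a\<close> itself need not be positive.\<close>
  have "nat (a + 10) \<in> pos_residue_class a" "nat (a + 20) \<in> pos_residue_class a"
    using assms mod_mult_self1[of a 2 10] by (auto simp: pos_residue_class_def cong_def)
  moreover have "Col (nat (a + 10)) = nat (c + 5)" "Col (nat (a + 20)) = nat (c + 10)"
    using assms c by (auto simp: Col_def even_nat_iff)
  moreover have "nat (c + 5) \<in> pos_residue_class (a div 2 + 5)"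
    "nat (c + 10) \<in> pos_residue_class (a div 2)"
    using assms c by (auto simp: pos_residue_class_def cong_def)
  ultimately have "\<exists>x \<in> pos_residue_class a. Col x \<in> pos_residue_class b"
    using b by (metis insertE singletonD)
  then show "b \<in> {b \<in> {0..9}. \<exists>x \<in> pos_residue_class a. Col x \<in> pos_residue_class b}"
    using assms b by auto
qed

theorem lemma4p1:
  fixes a :: int
  assumes "a \<in> verts Col_graph"
  shows "(out_degree Col_graph a = 1 \<longleftrightarrow> odd a)
    \<and> (out_degree Col_graph a = 2 \<longleftrightarrow> even a)"
proof -
  have a: "a \<in> {0..9}"
    using assms by (simp add: Col_graph_def)
  \<comment> \<open>Unfolding membership in \<open>{0..9}\<close> would rewrite the successor sets
    before the two lemmas could match them, hence the deletion.\<close>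
  show ?thesis
    by (cases "even a")
      (simp_all add: out_degree_Col_graph[OF a] Col_successors_even[OF a] Col_successors_odd[OF a]
        del: atLeastAtMost_iff)
qed

end
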